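(* Let $\Bbbk$ be a field and let $B=\Bbbk^{\oplus3}=\Bbbk e_1\oplus\Bbbk e_2\oplus\Bbbk e_3$ (with pointwise multiplication) be a bialgebra. Then $B$ is isomorphic, as a bialgebra, to one of the following 7 bialgebras, all having underlying algebra $\Bbbk e_1\oplus\Bbbk e_2\oplus\Bbbk e_3$ and counit $\varepsilon(e_1)=1$, $\varepsilon(e_2)=\varepsilon(e_3)=0$: (1) $\Delta(e_1)=e_1\otimes e_1+e_2\otimes e_3+e_3\otimes e_2$, $\Delta(e_2)=e_1\otimes e_2+e_2\otimes e_1+e_3\otimes e_3$, $\Delta(e_3)=e_1\otimes e_3+e_3\otimes e_1+e_2\otimes e_2$. (2) $\Delta(e_1)=e_1\otimes e_1+e_2\otimes e_2$, $\Delta(e_2)=e_1\otimes e_2+e_2\otimes e_1$, $\Delta(e_3)=e_1\otimes e_3+e_3\otimes e_1+e_2\otimes e_3+e_3\otimes e_2+e_3\otimes e_3$. (3) $\Delta(e_1)=e_1\otimes e_1$, $\Delta(e_2)=e_1\otimes e_2+e_2\otimes e_1+e_2\otimes e_2+e_2\otimes e_3$, $\Delta(e_3)=e_1\otimes e_3+e_3\otimes e_1+e_3\otimes e_2+e_3\otimes e_3$. (4) $\Delta(e_1)=e_1\otimes e_1$, $\Delta(e_2)=e_1\otimes e_2+e_2\otimes e_1+e_2\otimes e_2+e_3\otimes e_2$, $\Delta(e_3)=e_1\otimes e_3+e_3\otimes e_1+e_2\otimes e_3+e_3\otimes e_3$. (5) $\Delta(e_1)=e_1\otimes e_1$, $\Delta(e_2)=e_1\otimes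 e_2+e_2\otimes e_1+e_2\otimes e_2+e_3\otimes e_2+e_2\otimes e_3$, $\Delta(e_3)=e_1\otimes e_3+e_3\otimes e_1+e_3\otimes e_3$. (6) $\Delta(e_1)=e_1\otimes e_1$, $\Delta(e_2)=e_1\otimes e_2+e_2\otimes e_1+e_2\otimes e_2+e_3\otimes e_2+e_2\otimes e_3+e_3\otimes e_3$, $\Delta(e_3)=e_1\otimes e_3+e_3\otimes e_1$. (7) $\Delta(e_1)=e_1\otimes e_1$, $\Delta(e_2)=e_1\otimes e_2+e_2\otimes e_1+e_2\otimes e_2+e_3\otimes e_3$, $\Delta(e_3)=e_1\otimes e_3+e_3\otimes e_1+e_3\otimes e_2+e_2\otimes e_3$.
   Context: The algebra structure on $\Bbbk^{\oplus 3}$ is $e_ie_j=\delta_{ij}e_i$, $1=e_1+e_2+e_3$. A bialgebra is an algebra with a coassociative counital coalgebra structure $(\Delta,\varepsilon)$ such that $\Delta$ and $\varepsilon$ are unital algebra morphisms. A bialgebra isomorphism is a bijective linear map that is both an algebra and a coalgebra morphism. *)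

theory Defs
  imports "HOL-Analysis.Analysis"
begin

text \<open>
  The library's ring structure on \<open>'k ^ 'n\<close> is componentwise, so with basis vectors
  \<open>axis i 1\<close> it is the algebra of orthogonal idempotents with unit \<open>\<Sum>i. axis i 1\<close>.
  In particular \<open>'k ^ 3\<close> is the algebra of the theorem.  Its index type \<open>3\<close> consists of
  the residues modulo 3, hence has the elements \<open>1, 2, 3\<close> (with \<open>3 = 0\<close>).
\<close>

abbreviation e :: "'n::finite \<Rightarrow> 'k::field ^ 'n" where
  "e i \<equiv> axis i 1"


section \<open>Tensor products of coordinate spaces\<close>

text \<open>
  The tensor product of \<open>'k ^ 'm\<close> and \<open>'k ^ 'n\<close> is realised on \<open>'k ^ ('m \<times> 'n)\<close>, with
  \<open>e i \<otimes> e j\<close> the basis vector at \<open>(i, j)\<close>; the universal property is proved below.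
  The componentwise product on \<open>'k ^ ('m \<times> 'n)\<close> is the usual product of the tensor
  product algebra, by \<open>tensor_mult\<close> and \<open>tensor_one\<close>.
\<close>

definition tensor :: "'k::field ^ 'm \<Rightarrow> 'k ^ 'n \<Rightarrow> 'k ^ ('m \<times> 'n)"  (infixr "\<otimes>" 75) where
  "a \<otimes> b = (\<chi> p. a $ fst p * b $ snd p)"

definition tensor_lift ::
  "('k::field ^ 'm \<Rightarrow> 'k ^ 'n \<Rightarrow> 'k ^ 'p) \<Rightarrow> 'k ^ ('m \<times> 'n) \<Rightarrow> 'k ^ 'p" where
  "tensor_lift \<beta> t = (\<Sum>i\<in>UNIV. \<Sum>j\<in>UNIV. t $ (i, j) *s \<beta> (e i) (e j))"

definition tensor_map ::
  "('k::field ^ 'm \<Rightarrow> 'k ^ 'p) \<Rightarrow> ('k ^ 'n \<Rightarrow> 'k ^ 'q) \<Rightarrow> 'k ^ ('m \<times> 'n) \<Rightarrow> 'k ^ ('p \<times> 'q)" where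
  "tensor_map f g = tensor_lift (\<lambda>a b. f a \<otimes> g b)"

definition tensor_assoc ::
  "'k::field ^ (('l::finite \<times> 'm::finite) \<times> 'n::finite) \<Rightarrow> 'k ^ ('l \<times> ('m \<times> 'n))" where
  "tensor_assoc = tensor_lift (\<lambda>t c. tensor_lift (\<lambda>a b. a \<otimes> (b \<otimes> c)) t)"

abbreviation klinear :: "('k::field ^ 'm \<Rightarrow> 'k ^ 'n) \<Rightarrow> bool" where
  "klinear \<equiv> Vector_Spaces.linear (*s) (*s)"

lemma tensor_nth [simp]: "(a \<otimes> b) $ (i, j) = a $ i * b $ j"
  by (simp add: tensor_def)

lemma e_tensor_e: "e i \<otimes> e j = e (i, j)"
  by (auto simp: vec_eq_iff axis_def)

lemma tensor_add_left: "(a + a') \<otimes> b = a \<otimes> b + a' \<otimes> b"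
  and tensor_add_right: "a \<otimes> (b + b') = a \<otimes> b + a \<otimes> b'"
  and tensor_scale_left: "(c *s a) \<otimes> b = c *s (a \<otimes> b)"
  and tensor_scale_right: "a \<otimes> (c *s b) = c *s (a \<otimes> b)"
  by (auto simp: vec_eq_iff algebra_simps)

lemma tensor_mult: "(a \<otimes> b) * (a' \<otimes> b') = (a * a') \<otimes> (b * b')"
  and tensor_one: "1 \<otimes> 1 = 1"
  by (auto simp: vec_eq_iff algebra_simps)

lemma klinear_iff:
  "klinear f \<longleftrightarrow> (\<forall>x y. f (x + y) = f x + f y) \<and> (\<forall>c x. f (c *s x) = c *s f x)"
  unfolding Vector_Spaces.linear_def module_hom_def module_hom_axioms_def
  using vec.vector_space_axioms vec.module_axioms by (auto simp: vector_space_def module_def)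

lemma klinear_expand:
  assumes "klinear f"
  shows "f x = (\<Sum>i\<in>UNIV. x $ i *s f (e i))"
proof -
  interpret f: Vector_Spaces.linear "(*s)" "(*s)" f by fact
  have "f (\<Sum>i\<in>UNIV. x $ i *s e i) = (\<Sum>i\<in>UNIV. x $ i *s f (e i))"
    by (simp add: f.sum f.scale)
  then show ?thesis by (simp add: basis_expansion)
qed

theorem tensor_universal:
  fixes \<beta> :: "'k::field ^ 'm \<Rightarrow> 'k ^ 'n \<Rightarrow> 'k ^ 'p"
  assumes left: "\<And>b. klinear (\<lambda>a. \<beta> a b)" and right: "\<And>a. klinear (\<beta> a)"
  shows "klinear (tensor_lift \<beta>)"
    and "tensor_lift \<beta> (a \<otimes> b) = \<beta> a b"
    and "klinear g \<Longrightarrow> (\<And>a b. g (a \<otimes> b) = \<beta> a b) \<Longrightarrow> g = tensor_lift \<beta>"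
proof -
  show "klinear (tensor_lift \<beta>)"
    unfolding klinear_iff tensor_lift_def
    by (simp add: vec.scale_left_distrib sum.distrib vec.scale_sum_right)
  show "tensor_lift \<beta> (a \<otimes> b) = \<beta> a b"
    unfolding tensor_lift_def
    by (subst klinear_expand[OF left], subst klinear_expand[OF right])
       (simp add: vec.scale_sum_right)
  assume g: "klinear g" "\<And>a b. g (a \<otimes> b) = \<beta> a b"
  show "g = tensor_lift \<beta>"
  proof
    fix t
    have "g t = (\<Sum>p\<in>UNIV. t $ p *s g (e p))"
      by (rule klinear_expand[OF g(1)])
    also have "\<dots> = (\<Sum>i\<in>UNIV. \<Sum>j\<in>UNIV. t $ (i, j) *s g (e (i, j)))"
      by (simp add: sum.cartesian_product case_prod_unfold)
    also have "\<dots> = tensor_lift \<beta> t"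
      by (simp add: tensor_lift_def g(2) flip: e_tensor_e)
    finally show "g t = tensor_lift \<beta> t" .
  qed
qed

lemma tensor_assoc_nth: "tensor_assoc t $ (i, j, k) = t $ ((i, j), k)"
proof -
  have *: "tensor_lift (\<lambda>a b. a \<otimes> (b \<otimes> e k)) (e p) = e (fst p, snd p, k)" for p k
    by (cases p, simp only: fst_conv snd_conv flip: e_tensor_e, subst tensor_universal(2))
       (auto simp: klinear_iff tensor_add_left tensor_add_right tensor_scale_left tensor_scale_right)
  have "tensor_assoc t = (\<Sum>p\<in>UNIV. \<Sum>k\<in>UNIV. t $ (p, k) *s e (fst p, snd p, k))"
    unfolding tensor_assoc_def by (subst tensor_lift_def) (simp only: *)
  also have "\<dots> $ (i, j, k) =
      (\<Sum>p\<in>UNIV. \<Sum>k'\<in>UNIV. if (i, j) = p then if k = k' then t $ (p, k') else 0 else 0)"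
    by (auto simp: axis_def intro!: sum.cong)
  also have "\<dots> = (\<Sum>p\<in>UNIV. if (i, j) = p then t $ (p, k) else 0)"
    by (intro sum.cong refl) auto
  also have "\<dots> = t $ ((i, j), k)" by simp
  finally show ?thesis .
qed


section \<open>Bialgebra structures on coordinate algebras\<close>

text \<open>Homomorphisms of unital algebras; the arguments \<open>s\<^sub>1\<close> and \<open>s\<^sub>2\<close> are the scalar multiplications.\<close>

definition algebra_hom ::
  "('k::field \<Rightarrow> 'a::ring_1 \<Rightarrow> 'a) \<Rightarrow> ('k \<Rightarrow> 'b::ring_1 \<Rightarrow> 'b) \<Rightarrow> ('a \<Rightarrow> 'b) \<Rightarrow> bool" where
  "algebra_hom s\<^sub>1 s\<^sub>2 f \<longleftrightarrow>
     Vector_Spaces.linear s\<^sub>1 s\<^sub>2 f \<and> (\<forall>x y. f (x * y) = f x * f y) \<and> f 1 = 1"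

text \<open>In the counit axioms the base field tensored with \<open>'k ^ 'n\<close> is identified with \<open>'k ^ 'n\<close>.\<close>

definition coalgebra ::
  "('k::field ^ 'n \<Rightarrow> 'k ^ ('n \<times> 'n)) \<Rightarrow> ('k ^ 'n \<Rightarrow> 'k) \<Rightarrow> bool" where
  "coalgebra \<Delta> \<epsilon> \<longleftrightarrow>
     Vector_Spaces.linear (*s) (*s) \<Delta> \<and> Vector_Spaces.linear (*s) (*) \<epsilon> \<and>
     (\<forall>x. tensor_assoc (tensor_map \<Delta> id (\<Delta> x)) = tensor_map id \<Delta> (\<Delta> x)) \<and>
     (\<forall>x. tensor_lift (\<lambda>a b. \<epsilon> a *s b) (\<Delta> x) = x) \<and>
     (\<forall>x. tensor_lift (\<lambda>a b. \<epsilon> b *s a) (\<Delta> x) = x)"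

definition bialgebra ::
  "('k::field ^ 'n \<Rightarrow> 'k ^ ('n \<times> 'n)) \<Rightarrow> ('k ^ 'n \<Rightarrow> 'k) \<Rightarrow> bool" where
  "bialgebra \<Delta> \<epsilon> \<longleftrightarrow>
     coalgebra \<Delta> \<epsilon> \<and> algebra_hom (*s) (*s) \<Delta> \<and> algebra_hom (*s) (*) \<epsilon>"

definition coalgebra_hom ::
  "('k::field ^ 'm \<Rightarrow> 'k ^ ('m \<times> 'm)) \<Rightarrow> ('k ^ 'm \<Rightarrow> 'k) \<Rightarrow>
   ('k ^ 'n \<Rightarrow> 'k ^ ('n \<times> 'n)) \<Rightarrow> ('k ^ 'n \<Rightarrow> 'k) \<Rightarrow> ('k ^ 'm \<Rightarrow> 'k ^ 'n) \<Rightarrow> bool" where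
  "coalgebra_hom \<Delta> \<epsilon> \<Delta>' \<epsilon>' f \<longleftrightarrow>
     Vector_Spaces.linear (*s) (*s) f \<and>
     (\<forall>x. \<Delta>' (f x) = tensor_map f f (\<Delta> x)) \<and> (\<forall>x. \<epsilon>' (f x) = \<epsilon> x)"

definition bialgebra_iso ::
  "('k::field ^ 'm \<Rightarrow> 'k ^ ('m \<times> 'm)) \<Rightarrow> ('k ^ 'm \<Rightarrow> 'k) \<Rightarrow>
   ('k ^ 'n \<Rightarrow> 'k ^ ('n \<times> 'n)) \<Rightarrow> ('k ^ 'n \<Rightarrow> 'k) \<Rightarrow> ('k ^ 'm \<Rightarrow> 'k ^ 'n) \<Rightarrow> bool" where
  "bialgebra_iso \<Delta> \<epsilon> \<Delta>' \<epsilon>' f \<longleftrightarrow>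
     bij f \<and> algebra_hom (*s) (*s) f \<and> coalgebra_hom \<Delta> \<epsilon> \<Delta>' \<epsilon>' f"


section \<open>The seven bialgebra structures on the three-dimensional algebra\<close>

text \<open>The linear map sending \<open>e 1, e 2, e 3\<close> to \<open>u, v, w\<close>.\<close>

definition lin3 :: "'k::field ^ 'n \<Rightarrow> 'k ^ 'n \<Rightarrow> 'k ^ 'n \<Rightarrow> 'k ^ 3 \<Rightarrow> 'k ^ 'n" where
  "lin3 u v w x = x $ 1 *s u + x $ 2 *s v + x $ 3 *s w"

lemma lin3_basis [simp]:
  "lin3 u v w (e 1) = u" "lin3 u v w (e 2) = v" "lin3 u v w (e 3) = w"
  by (simp_all add: lin3_def axis_def vec_eq_iff)

lemma lin3_linear: "klinear (lin3 u v w)"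
  unfolding klinear_iff lin3_def by (simp add: vec_eq_iff algebra_simps)

definition counit3 :: "'k::field ^ 3 \<Rightarrow> 'k" where
  "counit3 x = x $ 1"

lemma counit3_basis [simp]:
  "counit3 (e 1) = 1" "counit3 (e 2) = 0" "counit3 (e 3) = 0"
  by (simp_all add: counit3_def axis_def)

definition comult1 :: "'k::field ^ 3 \<Rightarrow> 'k ^ (3 \<times> 3)" where
  "comult1 = lin3
     (e 1 \<otimes> e 1 + e 2 \<otimes> e 3 + e 3 \<otimes> e 2)
     (e 1 \<otimes> e 2 + e 2 \<otimes> e 1 + e 3 \<otimes> e 3)
     (e 1 \<otimes> e 3 + e 3 \<otimes> e 1 + e 2 \<otimes> e 2)"

definition comult2 :: "'k::field ^ 3 \<Rightarrow> 'k ^ (3 \<times> 3)" where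
  "comult2 = lin3
     (e 1 \<otimes> e 1 + e 2 \<otimes> e 2)
     (e 1 \<otimes> e 2 + e 2 \<otimes> e 1)
     (e 1 \<otimes> e 3 + e 3 \<otimes> e 1 + e 2 \<otimes> e 3 + e 3 \<otimes> e 2 + e 3 \<otimes> e 3)"

definition comult3 :: "'k::field ^ 3 \<Rightarrow> 'k ^ (3 \<times> 3)" where
  "comult3 = lin3
     (e 1 \<otimes> e 1)
     (e 1 \<otimes> e 2 + e 2 \<otimes> e 1 + e 2 \<otimes> e 2 + e 2 \<otimes> e 3)
     (e 1 \<otimes> e 3 + e 3 \<otimes> e 1 + e 3 \<otimes> e 2 + e 3 \<otimes> e 3)"

definition comult4 :: "'k::field ^ 3 \<Rightarrow> 'k ^ (3 \<times> 3)" where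
  "comult4 = lin3
     (e 1 \<otimes> e 1)
     (e 1 \<otimes> e 2 + e 2 \<otimes> e 1 + e 2 \<otimes> e 2 + e 3 \<otimes> e 2)
     (e 1 \<otimes> e 3 + e 3 \<otimes> e 1 + e 2 \<otimes> e 3 + e 3 \<otimes> e 3)"

definition comult5 :: "'k::field ^ 3 \<Rightarrow> 'k ^ (3 \<times> 3)" where
  "comult5 = lin3
     (e 1 \<otimes> e 1)
     (e 1 \<otimes> e 2 + e 2 \<otimes> e 1 + e 2 \<otimes> e 2 + e 3 \<otimes> e 2 + e 2 \<otimes> e 3)
     (e 1 \<otimes> e 3 + e 3 \<otimes> e 1 + e 3 \<otimes> e 3)"

definition comult6 :: "'k::field ^ 3 \<Rightarrow> 'k ^ (3 \<times> 3)" where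
  "comult6 = lin3
     (e 1 \<otimes> e 1)
     (e 1 \<otimes> e 2 + e 2 \<otimes> e 1 + e 2 \<otimes> e 2 + e 3 \<otimes> e 2 + e 2 \<otimes> e 3 + e 3 \<otimes> e 3)
     (e 1 \<otimes> e 3 + e 3 \<otimes> e 1)"

definition comult7 :: "'k::field ^ 3 \<Rightarrow> 'k ^ (3 \<times> 3)" where
  "comult7 = lin3
     (e 1 \<otimes> e 1)
     (e 1 \<otimes> e 2 + e 2 \<otimes> e 1 + e 2 \<otimes> e 2 + e 3 \<otimes> e 3)
     (e 1 \<otimes> e 3 + e 3 \<otimes> e 1 + e 3 \<otimes> e 2 + e 2 \<otimes> e 3)"

definition comults3 :: "('k::field ^ 3 \<Rightarrow> 'k ^ (3 \<times> 3)) set" where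
  "comults3 = {comult1, comult2, comult3, comult4, comult5, comult6, comult7}"

end

theory Submission
  imports Defs
begin

text \<open>
  The algebra \<open>'k ^ 'n\<close> is the algebra of functions on the finite set \<open>'n\<close>, and a field has no
  idempotents other than 0 and 1.  Hence its characters are exactly the coordinates
  (\<open>algebra_hom_to_field\<close>), and every algebra morphism between two such algebras is composition
  with a map of the index sets in the other direction (\<open>algebra_hom_imp_pullback\<close>).  Since
  \<open>'k ^ 'n \<otimes> 'k ^ 'n\<close> is the function algebra of \<open>'n \<times> 'n\<close>, a comultiplication is composition with
  a binary operation on \<open>'n\<close> and a counit is evaluation at an element of \<open>'n\<close>.  This passage from
  maps of sets to maps of algebras is faithful and compatible with tensor products, so the
  coalgebra axioms say exactly that the operation is a monoid with that element as unit
  (\<open>bialgebra_iff_monoid\<close>, \<open>bialgebraE\<close>), and isomorphic monoids give isomorphic bialgebras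
  (\<open>bialgebra_iso_pullback\<close>).

  The theorem thus becomes the classification of the monoids with three elements.  After
  renaming, the unit is 1, and such a monoid is given by the four products of the elements 2 and 3.
  Among the 81 tables the associative ones are, up to exchanging 2 and 3, the seven multiplication
  tables that belong to the listed comultiplications (\<open>monoid_mult3_imp_listed\<close>).
\<close>

section \<open>Algebra morphisms and maps of index sets\<close>

definition pullback :: "('n \<Rightarrow> 'm) \<Rightarrow> 'k::field ^ 'm \<Rightarrow> 'k ^ 'n" where
  "pullback \<phi> x = (\<chi> j. x $ \<phi> j)"

lemma pullback_nth [simp]: "pullback \<phi> x $ j = x $ \<phi> j"
  by (simp add: pullback_def)

lemma pullback_id: "pullback id = id"
  by (simp add: fun_eq_iff vec_eq_iff)

lemma pullback_pullback: "pullback \<psi> (pullback \<phi> x) = pullback (\<phi> \<circ> \<psi>) x"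
  by (simp add: vec_eq_iff)

lemma nth_eq_iff: "(\<forall>x :: 'k::field ^ 'n. x $ i = x $ j) \<longleftrightarrow> i = j"
proof
  assume "\<forall>x :: 'k ^ 'n. x $ i = x $ j"
  then have "(e i :: 'k ^ 'n) $ i = e i $ j" by blast
  then show "i = j" by (simp add: axis_def split: if_splits)
qed simp

lemma pullback_eq_iff:
  "(\<forall>x :: 'k::field ^ 'm. pullback \<phi> x = pullback \<psi> x) \<longleftrightarrow> \<phi> = \<psi>"
proof -
  have "(\<forall>x :: 'k ^ 'm. pullback \<phi> x = pullback \<psi> x) \<longleftrightarrow>
      (\<forall>j. \<forall>x :: 'k ^ 'm. x $ \<phi> j = x $ \<psi> j)"
    by (auto simp: vec_eq_iff)
  then show ?thesis by (simp add: nth_eq_iff fun_eq_iff)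
qed

lemma klinear_pullback: "klinear (pullback \<phi>)"
  by (simp add: klinear_iff vec_eq_iff)

lemma algebra_hom_pullback: "algebra_hom (*s) (*s) (pullback \<phi>)"
  by (simp add: algebra_hom_def klinear_pullback vec_eq_iff)

lemma linear_functional_iff:
  fixes g :: "'k::field ^ 'n \<Rightarrow> 'k"
  shows "Vector_Spaces.linear (*s) (*) g \<longleftrightarrow>
    (\<forall>x y. g (x + y) = g x + g y) \<and> (\<forall>c x. g (c *s x) = c * g x)"
proof -
  have "vector_space ((*) :: 'k \<Rightarrow> 'k \<Rightarrow> 'k)"
    by unfold_locales (simp_all add: algebra_simps)
  then show ?thesis
    unfolding Vector_Spaces.linear_def module_hom_def module_hom_axioms_def
    using vec.vector_space_axioms vec.module_axioms by (auto simp: vector_space_def module_def)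
qed

lemma algebra_hom_nth: "algebra_hom (*s) (*) (\<lambda>x :: 'k::field ^ 'n. x $ i)"
  by (simp add: algebra_hom_def linear_functional_iff)

text \<open>
  Some basis vector \<open>e i\<close> has nonzero image, since the images add up to 1.  Because
  \<open>e i * x = x $ i *s e i\<close>, applying \<open>g\<close> and cancelling \<open>g (e i)\<close> gives \<open>g x = x $ i\<close>.
\<close>

lemma algebra_hom_to_field:
  fixes g :: "'k::field ^ 'n \<Rightarrow> 'k"
  assumes "algebra_hom (*s) (*) g"
  obtains i where "g = (\<lambda>x. x $ i)"
proof -
  have add: "g (x + y) = g x + g y" and scale: "g (c *s x) = c * g x"
    and mult: "g (x * y) = g x * g y" and one: "g 1 = 1" for x y c
    using assms by (auto simp: algebra_hom_def linear_functional_iff)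
  have zero: "g 0 = 0" using scale[of 0 0] by simp
  have sum: "g (\<Sum>i\<in>A. h i) = (\<Sum>i\<in>A. g (h i))" for h and A :: "'n set"
    by (induction A rule: infinite_finite_induct) (simp_all add: zero add)
  have expand: "g x = (\<Sum>i\<in>UNIV. x $ i * g (e i))" for x
    by (subst basis_expansion[symmetric]) (simp add: sum scale)
  have "\<exists>i. g (e i) \<noteq> 0"
  proof (rule ccontr)
    assume "\<nexists>i. g (e i) \<noteq> 0"
    then show False using expand[of 1] one by simp
  qed
  then obtain i where i: "g (e i) \<noteq> 0" ..
  have nth: "e i * x = x $ i *s e i" for x :: "'k ^ 'n"
    by (simp add: vec_eq_iff axis_def)
  have "g x = x $ i" for x
    using mult[of "e i" x] i by (simp add: nth scale)
  then show ?thesis by (intro that) auto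
qed

lemma algebra_hom_imp_pullback:
  fixes f :: "'k::field ^ 'm \<Rightarrow> 'k ^ 'n"
  assumes "algebra_hom (*s) (*s) f"
  obtains \<phi> where "f = pullback \<phi>"
proof -
  have "\<exists>i. \<forall>x. f x $ j = x $ i" for j
  proof -
    have "algebra_hom (*s) (*) (\<lambda>x. f x $ j)"
      using assms by (simp add: algebra_hom_def linear_functional_iff klinear_iff)
    then show ?thesis by (rule algebra_hom_to_field) metis
  qed
  then obtain \<phi> where "\<And>j x. f x $ j = x $ \<phi> j" by metis
  then have "f = pullback \<phi>" by (simp add: fun_eq_iff vec_eq_iff)
  then show ?thesis by (rule that)
qed

section \<open>Bialgebras and monoids\<close>

lemma tensor_map_pullback: "tensor_map (pullback \<phi>) (pullback \<psi>) = pullback (map_prod \<phi> \<psi>)"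
  unfolding tensor_map_def
  by (rule tensor_universal(3)[symmetric])
     (auto simp: klinear_iff vec_eq_iff algebra_simps)

lemma tensor_assoc_pullback: "tensor_assoc = pullback (\<lambda>(i, j, k). ((i, j), k))"
  by (simp add: fun_eq_iff vec_eq_iff tensor_assoc_nth)

lemma tensor_lift_nth_left: "tensor_lift (\<lambda>a b. a $ u *s b) = pullback (\<lambda>i. (u, i))"
  by (rule tensor_universal(3)[symmetric])
     (auto simp: klinear_iff vec_eq_iff algebra_simps)

lemma tensor_lift_nth_right: "tensor_lift (\<lambda>a b. b $ u *s a) = pullback (\<lambda>i. (i, u))"
  by (rule tensor_universal(3)[symmetric])
     (auto simp: klinear_iff vec_eq_iff algebra_simps)

text \<open>
  Both sides of each coalgebra axiom are composition with a map of index sets, and distinct maps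
  of index sets give distinct maps of algebras.
\<close>

lemma bialgebra_iff_monoid:
  fixes m :: "'n::finite \<Rightarrow> 'n \<Rightarrow> 'n"
  shows "bialgebra (pullback (case_prod m) :: 'k::field ^ 'n \<Rightarrow> _) (\<lambda>x. x $ u) \<longleftrightarrow> monoid m u"
proof -
  let ?\<Delta> = "pullback (case_prod m) :: 'k ^ 'n \<Rightarrow> _"
  have map_left: "tensor_map ?\<Delta> id = pullback (map_prod (case_prod m) id)"
    and map_right: "tensor_map id ?\<Delta> = pullback (map_prod id (case_prod m))"
    by (simp_all flip: tensor_map_pullback pullback_id)
  have "(\<forall>x. tensor_assoc (tensor_map ?\<Delta> id (?\<Delta> x)) = tensor_map id ?\<Delta> (?\<Delta> x)) \<longleftrightarrow>
      (\<forall>a b c. m (m a b) c = m a (m b c))"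
    unfolding map_left map_right tensor_assoc_pullback pullback_pullback pullback_eq_iff
    by (simp add: fun_eq_iff)
  moreover have "(\<forall>x. tensor_lift (\<lambda>a b. a $ u *s b) (?\<Delta> x) = x) \<longleftrightarrow> (\<forall>a. m u a = a)"
    unfolding tensor_lift_nth_left pullback_pullback
    using pullback_eq_iff[of "case_prod m \<circ> (\<lambda>i. (u, i))" id, where ?'k = 'k]
    by (simp add: fun_eq_iff pullback_id)
  moreover have "(\<forall>x. tensor_lift (\<lambda>a b. b $ u *s a) (?\<Delta> x) = x) \<longleftrightarrow> (\<forall>a. m a u = a)"
    unfolding tensor_lift_nth_right pullback_pullback
    using pullback_eq_iff[of "case_prod m \<circ> (\<lambda>i. (i, u))" id, where ?'k = 'k]
    by (simp add: fun_eq_iff pullback_id)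
  moreover have "Vector_Spaces.linear (*s) (*) (\<lambda>x :: 'k ^ 'n. x $ u)"
    by (simp add: linear_functional_iff)
  ultimately show ?thesis
    by (simp add: bialgebra_def coalgebra_def algebra_hom_pullback algebra_hom_nth
        klinear_pullback monoid_def semigroup_def monoid_axioms_def)
qed

lemma bialgebraE:
  fixes \<Delta> :: "'k::field ^ 'n \<Rightarrow> 'k ^ ('n \<times> 'n)"
  assumes "bialgebra \<Delta> \<epsilon>"
  obtains m u where "\<Delta> = pullback (case_prod m)" "\<epsilon> = (\<lambda>x. x $ u)" "monoid m u"
proof -
  obtain \<phi> where \<phi>: "\<Delta> = pullback \<phi>"
    using assms algebra_hom_imp_pullback unfolding bialgebra_def by blast
  obtain u where u: "\<epsilon> = (\<lambda>x. x $ u)"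
    using assms algebra_hom_to_field unfolding bialgebra_def by blast
  have "\<Delta> = pullback (case_prod (curry \<phi>))" by (simp add: \<phi>)
  moreover from this have "monoid (curry \<phi>) u"
    using assms u bialgebra_iff_monoid by blast
  ultimately show ?thesis using u that by blast
qed

text \<open>
  The direction is reversed: the algebra morphism from the first bialgebra to the second is
  induced by a monoid isomorphism from the second index set to the first.
\<close>

lemma bialgebra_iso_pullback:
  fixes m :: "'m::finite \<Rightarrow> 'm \<Rightarrow> 'm" and m' :: "'n::finite \<Rightarrow> 'n \<Rightarrow> 'n"
  assumes "bij \<psi>" and "\<And>i j. \<psi> (m' i j) = m (\<psi> i) (\<psi> j)" and "\<psi> u' = u"
  shows "bialgebra_iso (pullback (case_prod m) :: 'k::field ^ 'm \<Rightarrow> _) (\<lambda>x. x $ u)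
    (pullback (case_prod m')) (\<lambda>x. x $ u') (pullback \<psi>)"
proof -
  have "bij (pullback \<psi> :: 'k ^ 'm \<Rightarrow> _)"
    using assms(1)
    by (intro o_bij[where g = "pullback (inv \<psi>)"])
       (simp_all add: fun_eq_iff vec_eq_iff bij_is_inj bij_is_surj surj_f_inv_f)
  moreover have "pullback (case_prod m') (pullback \<psi> x) =
      tensor_map (pullback \<psi>) (pullback \<psi>) (pullback (case_prod m) x)" for x :: "'k ^ 'm"
    by (simp add: tensor_map_pullback vec_eq_iff assms(2) split_beta)
  ultimately show ?thesis
    by (simp add: bialgebra_iso_def coalgebra_hom_def algebra_hom_pullback klinear_pullback assms(3))
qed

section \<open>Monoids with three elements\<close>

text \<open>
  A unital operation on three elements is determined by the products of its two non-units; the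
  quadruple lists these row by row.
\<close>

definition mult3 :: "3 \<times> 3 \<times> 3 \<times> 3 \<Rightarrow> 3 \<Rightarrow> 3 \<Rightarrow> 3" where
  "mult3 t i j = (case t of (p, q, r, s) \<Rightarrow>
     if i = 1 then j else if j = 1 then i
     else if i = 2 then (if j = 2 then p else q) else (if j = 2 then r else s))"

text \<open>
  In the order of the seven comultiplications: the cyclic group, the group of order 2 with a zero,
  the left zero and the right zero band with a unit, the chain as a semilattice, the null semigroup
  with a unit, and the group of order 2 with a new unit.
\<close>

definition tables3 :: "(3 \<times> 3 \<times> 3 \<times> 3) set" where
  "tables3 = {(3, 1, 1, 2), (1, 3, 3, 3), (2, 2, 3, 3), (2, 3, 2, 3), (2, 2, 2, 3),
     (2, 2, 2, 2), (2, 3, 3, 2)}"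

lemma comult_eq_pullback:
  shows "comult1 = pullback (case_prod (mult3 (3, 1, 1, 2)))"
    and "comult2 = pullback (case_prod (mult3 (1, 3, 3, 3)))"
    and "comult3 = pullback (case_prod (mult3 (2, 2, 3, 3)))"
    and "comult4 = pullback (case_prod (mult3 (2, 3, 2, 3)))"
    and "comult5 = pullback (case_prod (mult3 (2, 2, 2, 3)))"
    and "comult6 = pullback (case_prod (mult3 (2, 2, 2, 2)))"
    and "comult7 = pullback (case_prod (mult3 (2, 3, 3, 2)))"
  by (simp_all add: comult1_def comult2_def comult3_def comult4_def comult5_def comult6_def
      comult7_def fun_eq_iff vec_eq_iff split_paired_All forall_3 mult3_def lin3_def axis_def)

lemma comults3_eq: "comults3 = (\<lambda>t. pullback (case_prod (mult3 t))) ` tables3"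
  by (simp only: comults3_def tables3_def image_insert image_empty comult_eq_pullback)

lemma monoid_mult3_iff:
  "monoid (mult3 t) 1 \<longleftrightarrow> (\<forall>a b c. mult3 t (mult3 t a b) c = mult3 t a (mult3 t b c))"
  by (simp add: monoid_def semigroup_def monoid_axioms_def mult3_def split: prod.splits)

lemma monoid_mult3_listed:
  assumes "t \<in> tables3"
  shows "monoid (mult3 t) 1"
  using assms unfolding tables3_def monoid_mult3_iff
  by (elim insertE emptyE) (simp_all add: forall_3 mult3_def)

definition swap23 :: "3 \<Rightarrow> 3" where
  "swap23 = Transposition.transpose 2 3"

text \<open>
  A finite check over the 81 tables.  Exchanging 2 and 3 in a table also reverses the order of its
  entries, because the product of 2 with 2 becomes that of 3 with 3, and so on.
\<close>

lemma monoid_mult3_imp_listed: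
  assumes "monoid (mult3 (p, q, r, s)) 1"
  shows "(p, q, r, s) \<in> tables3 \<or> (swap23 s, swap23 r, swap23 q, swap23 p) \<in> tables3"
proof -
  have "\<forall>a b c. mult3 (p, q, r, s) (mult3 (p, q, r, s) a b) c =
      mult3 (p, q, r, s) a (mult3 (p, q, r, s) b c)"
    using assms unfolding monoid_mult3_iff .
  then show ?thesis
    using exhaust_3[of p] exhaust_3[of q] exhaust_3[of r] exhaust_3[of s]
    by (elim disjE) (simp_all add: forall_3 mult3_def tables3_def swap23_def Transposition.transpose_def)
qed

lemma mult3_swap:
  "mult3 (p, q, r, s) (swap23 i) (swap23 j) =
    swap23 (mult3 (swap23 s, swap23 r, swap23 q, swap23 p) i j)"
  using exhaust_3[of i] exhaust_3[of j]
  by (elim disjE) (simp_all add: mult3_def swap23_def)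

text \<open>
  Renaming the elements by the exchange of 1 and the unit turns the operation into some
  \<open>mult3 t\<close>; if the table \<open>t\<close> is not listed, then exchanging 2 and 3 makes it so.
\<close>

lemma monoid_3_classification:
  fixes m :: "3 \<Rightarrow> 3 \<Rightarrow> 3"
  assumes "monoid m u"
  obtains t \<psi> where "t \<in> tables3" "bij \<psi>" "\<And>i j. \<psi> (mult3 t i j) = m (\<psi> i) (\<psi> j)" "\<psi> 1 = u"
proof -
  interpret monoid m u by fact
  define \<sigma> where "\<sigma> = Transposition.transpose 1 u"
  have \<sigma>: "\<sigma> (\<sigma> i) = i" "\<sigma> 1 = u" "\<sigma> u = 1" "bij \<sigma>" for i by (simp_all add: \<sigma>_def)
  define p q r s where pqrs: "p = \<sigma> (m (\<sigma> 2) (\<sigma> 2))" "q = \<sigma> (m (\<sigma> 2) (\<sigma> 3))"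
    "r = \<sigma> (m (\<sigma> 3) (\<sigma> 2))" "s = \<sigma> (m (\<sigma> 3) (\<sigma> 3))"
  have mult: "mult3 (p, q, r, s) i j = \<sigma> (m (\<sigma> i) (\<sigma> j))" for i j
    using exhaust_3[of i] exhaust_3[of j]
    by (elim disjE) (simp_all add: mult3_def pqrs \<sigma>)
  have "monoid (mult3 (p, q, r, s)) 1"
    by unfold_locales (simp_all add: mult \<sigma> assoc)
  then consider "(p, q, r, s) \<in> tables3" | "(swap23 s, swap23 r, swap23 q, swap23 p) \<in> tables3"
    using monoid_mult3_imp_listed by blast
  then show ?thesis
  proof cases
    case 1
    then show ?thesis using that \<sigma> mult by metis
  next
    case 2
    have "(\<sigma> \<circ> swap23) (mult3 (swap23 s, swap23 r, swap23 q, swap23 p) i j) =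
        m ((\<sigma> \<circ> swap23) i) ((\<sigma> \<circ> swap23) j)" for i j
      by (simp add: mult \<sigma> flip: mult3_swap)
    moreover have "bij (\<sigma> \<circ> swap23)" by (intro bij_comp) (simp_all add: \<sigma> swap23_def)
    moreover have "(\<sigma> \<circ> swap23) 1 = u" by (simp add: swap23_def \<sigma>)
    ultimately show ?thesis using that 2 by blast
  qed
qed

theorem theorem5p1:
  fixes \<Delta> :: "'k::field ^ 3 \<Rightarrow> 'k ^ (3 \<times> 3)" and \<epsilon> :: "'k ^ 3 \<Rightarrow> 'k"
  assumes "bialgebra \<Delta> \<epsilon>"
  shows "(\<forall>\<Delta>' \<in> (comults3 :: ('k ^ 3 \<Rightarrow> 'k ^ (3 \<times> 3)) set). bialgebra \<Delta>' counit3) \<and>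
    (\<exists>\<Delta>' \<in> comults3. \<exists>f :: 'k ^ 3 \<Rightarrow> 'k ^ 3. bialgebra_iso \<Delta> \<epsilon> \<Delta>' counit3 f)"
proof
  have counit3: "counit3 = (\<lambda>x :: 'k ^ 3. x $ 1)" by (simp add: fun_eq_iff counit3_def)
  show "\<forall>\<Delta>' \<in> (comults3 :: ('k ^ 3 \<Rightarrow> 'k ^ (3 \<times> 3)) set). bialgebra \<Delta>' counit3"
    by (auto simp: comults3_eq counit3 bialgebra_iff_monoid monoid_mult3_listed)
  obtain m u where \<Delta>: "\<Delta> = pullback (case_prod m)" and \<epsilon>: "\<epsilon> = (\<lambda>x. x $ u)" and "monoid m u"
    using assms by (rule bialgebraE)
  then obtain t \<psi> where t: "t \<in> tables3" "bij \<psi>" "\<And>i j. \<psi> (mult3 t i j) = m (\<psi> i) (\<psi> j)" "\<psi> 1 = u"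
    using monoid_3_classification by blast
  have "bialgebra_iso \<Delta> \<epsilon> (pullback (case_prod (mult3 t))) counit3 (pullback \<psi>)"
    unfolding \<Delta> \<epsilon> counit3 using t(2-4) by (rule bialgebra_iso_pullback)
  then show "\<exists>\<Delta>' \<in> comults3. \<exists>f :: 'k ^ 3 \<Rightarrow> 'k ^ 3. bialgebra_iso \<Delta> \<epsilon> \<Delta>' counit3 f"
    using t(1) by (auto simp: comults3_eq)
qed

end
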